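(* Let $B$ be a skew brace with property (S). Let $T_+(B)$ be the set of elements of finite order of the group $(B,+)$ and $T_\circ(B)$ the set of elements of finite order of the group $(B,\circ)$. Then: (1) $T_+(B)=T_\circ(B)$; (2) $T_+(B)$ is an ideal of $B$; (3) $T_+\big(B/T_+(B)\big)=\{0\}$; (4) if $B$ is finitely generated (as a skew brace), then $T_+(B)$ is finite.
   Context: A skew (left) brace is a triple $(B,+,\circ)$ where $(B,+)$ and $(B,\circ)$ are (not necessarily abelian) groups such that $a\circ(b+c)=a\circ b-a+a\circ c$ for all $a,b,c\in B$. The two identities coincide and are denoted $0$. Put $\lambda_a(b)=-a+a\circ b$ and $a\ast b=\lambda_a(b)-b=-a+a\circ b-b$. For $x\in B$ let $\operatorname{Fix}^r(x)=\{b\in B: x\ast b=0\}$ (a subgroup of $(B,+)$), $\operatorname{Fix}^l(x)=\{b\in B: b\ast x=0\}$ (a subgroup of $(B,\circ)$), and let $C_x^+$, $C_x^\circ$ be the centralisers of $x$ in $(B,+)$ and $(B,\circ)$. An element $x$ has property (s) if the indices $|(B,+):\operatorname{Fix}^r(x)\cap C_x^+|$ and $|(B,\circ):\operatorname{Fix}^l(x)\cap C_x^\circ|$ are both finite. $B$ has property (S) if all its elements have property (s). An ideal of $B$ is a subset $I$ that is a normal subgroup of both $(B,+)$ and $(B,\circ)$ and satisfies $\lambda_a(I)\subseteq I$ for all $a\in B$; then $a+I=a\circ I$ for all $a\in B$ and $B/I$ is a skew brace. A sub-skew brace of $B$ is a subset that is a subgroup of both $(B,+)$ and $(B,\circ)$.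 $B$ is finitely generated if there is a finite subset $E\subseteq B$ such that $B$ is the smallest sub-skew brace of $B$ containing $E$. *)

theory Defs
  imports "HOL-Algebra.QuotRing"
begin

text \<open>
  A skew brace is carried by a ring record: \<open>\<oplus>\<close> (group \<open>add_monoid B\<close>) is the
  additive operation, and \<open>\<otimes>\<close> (group \<open>B\<close>) is the circle operation.  Neither is assumed to be
  commutative.  The record has two identity fields, which coincide by \<open>one_eq_zero\<close> below.
\<close>

locale skew_brace = add: group "add_monoid B" + group B for B (structure) +
  assumes brace_eq:
    "\<lbrakk>a \<in> carrier B; b \<in> carrier B; c \<in> carrier B\<rbrakk> \<Longrightarrow>
       a \<otimes> (b \<oplus> c) = (a \<otimes> b \<ominus> a) \<oplus> (a \<otimes> c)"

definition lam :: "('a, 'm) ring_scheme \<Rightarrow> 'a \<Rightarrow> 'a \<Rightarrow> 'a" where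
  "lam B a b = (\<ominus>\<^bsub>B\<^esub> a) \<oplus>\<^bsub>B\<^esub> (a \<otimes>\<^bsub>B\<^esub> b)"

definition star :: "('a, 'm) ring_scheme \<Rightarrow> 'a \<Rightarrow> 'a \<Rightarrow> 'a" where
  "star B a b = lam B a b \<ominus>\<^bsub>B\<^esub> b"

definition Fix_r :: "('a, 'm) ring_scheme \<Rightarrow> 'a \<Rightarrow> 'a set" where
  "Fix_r B x = {b \<in> carrier B. star B x b = \<zero>\<^bsub>B\<^esub>}"

definition Fix_l :: "('a, 'm) ring_scheme \<Rightarrow> 'a \<Rightarrow> 'a set" where
  "Fix_l B x = {b \<in> carrier B. star B b x = \<zero>\<^bsub>B\<^esub>}"

definition centraliser :: "('a, 'm) monoid_scheme \<Rightarrow> 'a \<Rightarrow> 'a set" where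
  "centraliser G x = {y \<in> carrier G. x \<otimes>\<^bsub>G\<^esub> y = y \<otimes>\<^bsub>G\<^esub> x}"

definition finite_index :: "('a, 'm) monoid_scheme \<Rightarrow> 'a set \<Rightarrow> bool" where
  "finite_index G H \<longleftrightarrow> finite (rcosets\<^bsub>G\<^esub> H)"

definition property_s :: "('a, 'm) ring_scheme \<Rightarrow> 'a \<Rightarrow> bool" where
  "property_s B x \<longleftrightarrow>
     finite_index (add_monoid B) (Fix_r B x \<inter> centraliser (add_monoid B) x) \<and>
     finite_index B (Fix_l B x \<inter> centraliser B x)"

definition property_S :: "('a, 'm) ring_scheme \<Rightarrow> bool" where
  "property_S B \<longleftrightarrow> (\<forall>x \<in> carrier B. property_s B x)"

definition torsion :: "('a, 'm) monoid_scheme \<Rightarrow> 'a set" where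
  "torsion G = {x \<in> carrier G. \<exists>n::nat. n > 0 \<and> x [^]\<^bsub>G\<^esub> n = \<one>\<^bsub>G\<^esub>}"

definition T_plus :: "('a, 'm) ring_scheme \<Rightarrow> 'a set" where
  "T_plus B = torsion (add_monoid B)"

definition T_circ :: "('a, 'm) ring_scheme \<Rightarrow> 'a set" where
  "T_circ B = torsion B"

definition brace_ideal :: "'a set \<Rightarrow> ('a, 'm) ring_scheme \<Rightarrow> bool" where
  "brace_ideal I B \<longleftrightarrow>
     I \<lhd> add_monoid B \<and> I \<lhd> B \<and> (\<forall>a \<in> carrier B. lam B a ` I \<subseteq> I)"

definition sub_skew_brace :: "'a set \<Rightarrow> ('a, 'm) ring_scheme \<Rightarrow> bool" where
  "sub_skew_brace H B \<longleftrightarrow> subgroup H (add_monoid B) \<and> subgroup H B"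

definition finitely_generated_brace :: "('a, 'm) ring_scheme \<Rightarrow> bool" where
  "finitely_generated_brace B \<longleftrightarrow>
     (\<exists>E. finite E \<and> E \<subseteq> carrier B \<and> \<Inter>{H. sub_skew_brace H B \<and> E \<subseteq> H} = carrier B)"

context skew_brace
begin

lemma minus_closed [simp]: "a \<in> carrier B \<Longrightarrow> \<ominus> a \<in> carrier B"
  using add.inv_closed[of a] by (simp add: a_inv_def)

lemma plus_closed [simp]: "\<lbrakk>a \<in> carrier B; b \<in> carrier B\<rbrakk> \<Longrightarrow> a \<oplus> b \<in> carrier B"
  using add.m_closed[of a b] by simp

lemma zero_in [simp]: "\<zero> \<in> carrier B"
  using add.one_closed by simp

lemma plus_assoc:
  "\<lbrakk>a \<in> carrier B; b \<in> carrier B; c \<in> carrier B\<rbrakk> \<Longrightarrow> (a \<oplus> b) \<oplus> c = a \<oplus> (b \<oplus> c)"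
  using add.m_assoc[of a b c] by simp

lemma plus_simps [simp]:
  assumes "a \<in> carrier B"
  shows "\<zero> \<oplus> a = a" "a \<oplus> \<zero> = a" "\<ominus> a \<oplus> a = \<zero>" "a \<oplus> \<ominus> a = \<zero>"
  using add.l_one[of a] add.r_one[of a] add.l_inv[of a] add.r_inv[of a] assms
  by (simp_all add: a_inv_def)

lemma plus_minus_cancel [simp]:
  assumes "a \<in> carrier B" "b \<in> carrier B"
  shows "a \<oplus> (\<ominus> a \<oplus> b) = b" "\<ominus> a \<oplus> (a \<oplus> b) = b"
  using assms by (simp_all add: plus_assoc[symmetric])

lemma one_eq_zero: "\<one> = \<zero>"
proof -
  have "\<zero> \<otimes> \<zero> = \<zero> \<otimes> \<zero> \<oplus> (\<ominus> \<zero> \<oplus> \<zero> \<otimes> \<zero>)"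
    using brace_eq[of "\<zero>" \<zero> \<zero>] by (simp add: a_minus_def plus_assoc)
  then have "\<ominus> \<zero> \<oplus> \<zero> \<otimes> \<zero> = \<zero>"
    by (metis m_closed minus_closed plus_closed plus_minus_cancel(2) plus_simps(3) zero_in)
  then have "\<zero> \<otimes> \<zero> = \<zero>"
    by (metis m_closed plus_minus_cancel(1) plus_simps(2) zero_in)
  then show ?thesis using r_cancel_one' zero_in by metis
qed

lemma times_eq_plus_lam:
  "\<lbrakk>a \<in> carrier B; b \<in> carrier B\<rbrakk> \<Longrightarrow> a \<otimes> b = a \<oplus> lam B a b"
  by (simp add: lam_def)

lemma lam_closed [simp]: "\<lbrakk>a \<in> carrier B; b \<in> carrier B\<rbrakk> \<Longrightarrow> lam B a b \<in> carrier B"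
  by (simp add: lam_def)

lemma times_lam_inv:
  assumes "a \<in> carrier B" "b \<in> carrier B"
  shows "a \<otimes> lam B (inv a) b = a \<oplus> b"
proof -
  have "a = a \<otimes> (inv a \<oplus> \<ominus> (inv a))" using assms r_one[of a] one_eq_zero by simp
  also have "\<dots> = \<ominus> a \<oplus> a \<otimes> (\<ominus> (inv a))"
    using assms brace_eq[of a "inv a" "\<ominus> (inv a)"] one_eq_zero by (simp add: a_minus_def)
  finally have eq: "a \<otimes> (\<ominus> (inv a)) = a \<oplus> a"
    using assms by (metis inv_closed m_closed minus_closed plus_minus_cancel(1))
  have "a \<otimes> lam B (inv a) b = (a \<otimes> (\<ominus> (inv a)) \<ominus> a) \<oplus> a \<otimes> (inv a \<otimes> b)"
    unfolding lam_def using assms by (intro brace_eq) auto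
  also have "\<dots> = a \<oplus> b"
    using assms by (simp add: eq a_minus_def plus_assoc m_assoc[symmetric])
  finally show ?thesis .
qed

lemma brace_ideal_cosets_eq:
  assumes I: "brace_ideal I B" and a: "a \<in> carrier B"
  shows "I +> a = I #> a"
proof -
  interpret N: normal I "add_monoid B" using I by (simp add: brace_ideal_def)
  interpret M: normal I B using I by (simp add: brace_ideal_def)
  have sub: "I \<subseteq> carrier B" by (rule M.subset)
  have lam: "lam B c i \<in> I" if "c \<in> carrier B" "i \<in> I" for c i
    using I that by (auto simp: brace_ideal_def)
  have "I +> a = a <#\<^bsub>add_monoid B\<^esub> I"
    using N.coset_eq a by (simp add: a_r_coset_def)
  also have "\<dots> = (\<lambda>i. a \<oplus> i) ` I" by (auto simp: l_coset_def)
  also have "\<dots> = (\<lambda>i. a \<otimes> i) ` I"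
  proof (intro equalityI image_subsetI)
    fix i assume i: "i \<in> I"
    show "a \<oplus> i \<in> (\<lambda>i. a \<otimes> i) ` I"
      using times_lam_inv[of a i] a i sub lam[of "inv a" i]
      by (metis image_eqI inv_closed subsetD)
    show "a \<otimes> i \<in> (\<lambda>i. a \<oplus> i) ` I"
      using times_eq_plus_lam[of a i] a i sub lam[of a i] by blast
  qed
  also have "\<dots> = a <# I" by (auto simp: l_coset_def)
  also have "\<dots> = I #> a" using M.coset_eq a by simp
  finally show ?thesis .
qed

text \<open>
  For a brace ideal the library's quotient \<open>B Quot I\<close> has the cosets of \<open>I\<close> as carrier,
  with both operations computed on representatives.
\<close>

lemma brace_quot_simps:
  assumes I: "brace_ideal I B"
  shows "carrier (B Quot I) = (\<lambda>a. I +> a) ` carrier B"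
    and "\<zero>\<^bsub>B Quot I\<^esub> = I"
    and "\<one>\<^bsub>B Quot I\<^esub> = I"
    and "\<And>a b. \<lbrakk>a \<in> carrier B; b \<in> carrier B\<rbrakk> \<Longrightarrow>
           (I +> a) \<oplus>\<^bsub>B Quot I\<^esub> (I +> b) = I +> (a \<oplus> b)"
    and "\<And>a b. \<lbrakk>a \<in> carrier B; b \<in> carrier B\<rbrakk> \<Longrightarrow>
           (I +> a) \<otimes>\<^bsub>B Quot I\<^esub> (I +> b) = I +> (a \<otimes> b)"
proof -
  interpret N: normal I "add_monoid B" using I by (simp add: brace_ideal_def)
  interpret M: normal I B using I by (simp add: brace_ideal_def)
  show "carrier (B Quot I) = (\<lambda>a. I +> a) ` carrier B"
    by (auto simp: FactRing_def A_RCOSETS_def RCOSETS_def a_r_coset_def)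
  show "\<zero>\<^bsub>B Quot I\<^esub> = I" by (simp add: FactRing_def)
  show "\<one>\<^bsub>B Quot I\<^esub> = I"
    using brace_ideal_cosets_eq[OF I one_closed] M.subset by (simp add: FactRing_def)
  fix a b assume a: "a \<in> carrier B" and b: "b \<in> carrier B"
  show "(I +> a) \<oplus>\<^bsub>B Quot I\<^esub> (I +> b) = I +> (a \<oplus> b)"
    using N.rcos_sum[of a b] a b by (simp add: FactRing_def set_add_def a_r_coset_def)
  have ab: "I +> (c \<otimes> d) = I +> (a \<otimes> b)" if "c \<in> I +> a" "d \<in> I +> b" for c d
  proof -
    have c: "c \<in> I #> a" and d: "d \<in> I #> b"
      using that brace_ideal_cosets_eq[OF I] a b by auto
    then have cC: "c \<in> carrier B" and dC: "d \<in> carrier B"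
      using a b M.subset r_coset_subset_G by blast+
    have "c \<otimes> d \<in> (I #> a) <#> (I #> b)" using c d by (auto simp: set_mult_def)
    then have "c \<otimes> d \<in> I #> (a \<otimes> b)" using M.rcos_sum a b by simp
    then have "I #> (c \<otimes> d) = I #> (a \<otimes> b)"
      using repr_independence a b M.is_subgroup by auto
    then show ?thesis using brace_ideal_cosets_eq[OF I] a b cC dC by simp
  qed
  have "a \<in> I +> a" "b \<in> I +> b"
    using brace_ideal_cosets_eq[OF I] rcos_self a b M.is_subgroup by auto
  then have ne: "I +> a \<noteq> {}" "I +> b \<noteq> {}" by blast+
  have "(\<Union>c \<in> I +> a. \<Union>d \<in> I +> b. I +> (c \<otimes> d)) =
      (\<Union>c \<in> I +> a. \<Union>d \<in> I +> b. I +> (a \<otimes> b))"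
    by (intro SUP_cong refl ab)
  also have "\<dots> = I +> (a \<otimes> b)"
    by (simp only: UN_constant ne if_False)
  finally show "(I +> a) \<otimes>\<^bsub>B Quot I\<^esub> (I +> b) = I +> (a \<otimes> b)"
    by (simp add: FactRing_def rcoset_mult_def)
qed

lemma skew_brace_quot:
  assumes I: "brace_ideal I B"
  shows "skew_brace (B Quot I)"
proof -
  interpret N: normal I "add_monoid B" using I by (simp add: brace_ideal_def)
  interpret M: normal I B using I by (simp add: brace_ideal_def)
  note q = brace_quot_simps[OF I]
  have I0: "I +> \<zero> = I"
    using brace_ideal_cosets_eq[OF I one_closed] coset_mult_one[OF M.subset]
    by (simp add: one_eq_zero)
  have A: "group (add_monoid (B Quot I))"
  proof (rule groupI, goal_cases)
    case (5 x)
    then obtain a where a: "a \<in> carrier B" "x = I +> a" by (auto simp: q)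
    show ?case using a by (intro bexI[of _ "I +> \<ominus> a"]) (auto simp: q I0)
  next
    case 2 show ?case using imageI[OF zero_in, of "\<lambda>a. I +> a"] by (simp add: q I0)
  next
    case (4 x)
    then obtain a where a: "a \<in> carrier B" "x = I +> a" by (auto simp: q)
    have "(I +> \<zero>) \<oplus>\<^bsub>B Quot I\<^esub> (I +> a) = I +> a" using a by (subst q) auto
    then show ?case using a by (simp add: q I0)
  qed (auto simp: q plus_assoc)
  have M: "group (B Quot I)"
  proof (rule groupI, goal_cases)
    case (5 x)
    then obtain a where a: "a \<in> carrier B" "x = I +> a" by (auto simp: q)
    show ?case using a
      by (intro bexI[of _ "I +> inv a"]) (auto simp: q I0 one_eq_zero)
  next
    case 2 show ?case using imageI[OF zero_in, of "\<lambda>a. I +> a"] by (simp add: q I0)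
  next
    case (4 x)
    then obtain a where a: "a \<in> carrier B" "x = I +> a" by (auto simp: q)
    have "(I +> \<one>) \<otimes>\<^bsub>B Quot I\<^esub> (I +> a) = I +> a" using a by (subst q) auto
    then show ?case using a by (simp add: q I0 one_eq_zero)
  qed (auto simp: q m_assoc)
  interpret QA: group "add_monoid (B Quot I)" by (rule A)
  have neg: "\<ominus>\<^bsub>B Quot I\<^esub> (I +> a) = I +> \<ominus> a" if "a \<in> carrier B" for a
    unfolding a_inv_def[of "B Quot I"]
    using that by (intro QA.inv_equality) (auto simp: q I0)
  show ?thesis
  proof (intro skew_brace.intro skew_brace_axioms.intro A M)
    fix x y z assume "x \<in> carrier (B Quot I)" "y \<in> carrier (B Quot I)" "z \<in> carrier (B Quot I)"
    then obtain a b c where "a \<in> carrier B" "b \<in> carrier B" "c \<in> carrier B"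
      "x = I +> a" "y = I +> b" "z = I +> c" by (auto simp: q)
    then show "x \<otimes>\<^bsub>B Quot I\<^esub> (y \<oplus>\<^bsub>B Quot I\<^esub> z) =
        (x \<otimes>\<^bsub>B Quot I\<^esub> y \<ominus>\<^bsub>B Quot I\<^esub> x) \<oplus>\<^bsub>B Quot I\<^esub> (x \<otimes>\<^bsub>B Quot I\<^esub> z)"
      using brace_eq[of a b c]
      by (simp add: q neg a_minus_def[of "B Quot I"] a_minus_def[of B])
  qed
qed

end

end

theory Submission
  imports Defs "HOL-Algebra.Generated_Groups"
begin

text \<open>
  Property (S) says in particular that both groups of \<open>B\<close> are FC-groups.  The classical facts
  about an FC-group \<open>G\<close> behind the theorem are these: its torsion elements form a normal subgroup;
  moreover, \<open>x\<^sup>k = y\<^sup>k\<close> with \<open>k > 0\<close> forces \<open>x y\<inverse>\<close> to be torsion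
  (\<open>torsion_if_pow_eq\<close>, by means of the transfer into a central subgroup of finite index); and the
  torsion subgroup is finite if \<open>G\<close> is finitely generated
  (\<open>finite_torsion_if_finitely_generated\<close>, by Schreier's argument and an induction in the abelian
  case).

  Write \<open>T\<close> for the torsion subgroup of \<open>(B, +)\<close>.  Each \<open>\<lambda>\<^sub>a\<close> is an automorphism of \<open>(B, +)\<close> and
  therefore preserves \<open>T\<close>.  It fixes a positive multiple of every \<open>b\<close>, since \<open>Fix\<^sup>r(a)\<close> contains a
  set of finite index, so \<open>\<lambda>\<^sub>a(b) - b \<in> T\<close> (\<open>star_mem_T_plus\<close>): modulo \<open>T\<close> the two operations
  coincide.  In particular the \<open>n\<close>-th power of \<open>x\<close> in \<open>(B, \<circ>)\<close> is congruent to \<open>n x\<close> modulo \<open>T\<close>,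
  and \<open>\<circ>\<close>-torsion elements are additive torsion elements.  The converse uses the finite
  \<open>\<lambda>\<close>-orbits that \<open>Fix\<^sup>l\<close> provides: a power \<open>y\<close> of \<open>x\<close> satisfies \<open>\<lambda>\<^sub>y(y) = y\<close>, and for such
  \<open>y\<close> powers and multiples are the same.  Hence the two torsion sets agree and form an ideal with
  torsion-free quotient.

  If \<open>B\<close> is finitely generated as a skew brace, the finitely many \<open>\<lambda>\<close>-images of the generators
  already generate \<open>(B, +)\<close> as a group (\<open>finitely_generated_additive_group\<close>), and the finiteness of
  \<open>T\<close> is the statement about finitely generated FC-groups.
\<close>

section \<open>Subsets of finite index\<close>

context group
begin

text \<open>
  Stated for subsets, because each index condition of property (s) concerns the set of common
  solutions of two equations.
\<close>

lemma coset_eq_imp_quotient_mem: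
  assumes "\<one> \<in> H" "H \<subseteq> carrier G" "g \<in> carrier G" "h \<in> carrier G" "H #> g = H #> h"
  shows "g \<otimes> inv h \<in> H"
proof -
  have "g \<in> H #> g" using assms by (force simp: r_coset_def)
  then obtain k where k: "k \<in> H" "g = k \<otimes> h" using assms by (auto simp: r_coset_def)
  then have "g \<otimes> inv h = k" using assms by (simp add: m_assoc subsetD)
  then show ?thesis using k by simp
qed

lemma rcosets_eq_image: "rcosets H = (\<lambda>g. H #> g) ` carrier G"
  by (auto simp: RCOSETS_def)

lemma finite_indexI:
  assumes "subgroup H G" "finite (f ` carrier G)"
    and "\<And>g h. \<lbrakk>g \<in> carrier G; h \<in> carrier G; f g = f h\<rbrakk> \<Longrightarrow> g \<otimes> inv h \<in> H"
  shows "finite_index G H"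
proof -
  let ?r = "\<lambda>v. SOME g. g \<in> carrier G \<and> f g = v"
  have "H #> g = H #> ?r (f g)" if g: "g \<in> carrier G" for g
  proof -
    have r: "?r (f g) \<in> carrier G \<and> f (?r (f g)) = f g"
      by (rule someI[of _ g]) (use g in simp)
    then have "g \<otimes> inv (?r (f g)) \<in> H" using assms(3)[of g "?r (f g)"] g by simp
    then have "g \<in> H #> ?r (f g)" using r g subgroup.rcos_module_rev[OF assms(1) is_group] by blast
    then show ?thesis using repr_independence[OF _ _ assms(1)] r by blast
  qed
  then have "rcosets H \<subseteq> (\<lambda>v. H #> ?r v) ` f ` carrier G"
    by (auto simp: rcosets_eq_image)
  then show ?thesis unfolding finite_index_def using assms(2) finite_surj by blast
qed

lemma finite_index_mono:
  assumes "finite_index G H" "\<one> \<in> H" "H \<subseteq> K" "subgroup K G"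
  shows "finite_index G K"
proof (rule finite_indexI[OF assms(4), of "(#>) H"])
  show "finite ((#>) H ` carrier G)"
    using assms(1) by (simp add: finite_index_def rcosets_eq_image)
  show "g \<otimes> inv h \<in> K" if "g \<in> carrier G" "h \<in> carrier G" "H #> g = H #> h" for g h
    using coset_eq_imp_quotient_mem[of H g h] assms that subgroup.subset[OF assms(4)] by blast
qed

lemma finite_index_Int:
  assumes "subgroup H G" "subgroup K G" "finite_index G H" "finite_index G K"
  shows "finite_index G (H \<inter> K)"
proof (rule finite_indexI[of _ "\<lambda>g. (H #> g, K #> g)"])
  show "subgroup (H \<inter> K) G" using assms subgroups_Inter_pair by blast
  have "(\<lambda>g. (H #> g, K #> g)) ` carrier G \<subseteq> (rcosets H) \<times> (rcosets K)"
    by (auto simp: rcosets_eq_image)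
  then show "finite ((\<lambda>g. (H #> g, K #> g)) ` carrier G)"
    using assms(3,4) by (auto simp: finite_index_def intro: finite_subset)
  show "g \<otimes> inv h \<in> H \<inter> K"
    if "g \<in> carrier G" "h \<in> carrier G" "(H #> g, K #> g) = (H #> h, K #> h)" for g h
    using that coset_eq_imp_quotient_mem subgroup.one_closed subgroup.subset assms(1,2)
    by (metis IntI prod.inject)
qed

lemma finite_index_restrict:
  assumes "subgroup H G" "subgroup K G" "finite_index G K"
  shows "finite_index (G\<lparr>carrier := H\<rparr>) (H \<inter> K)"
proof (rule group.finite_indexI[of _ _ "(#>) K"])
  show "group (G\<lparr>carrier := H\<rparr>)" by (rule subgroup_imp_group[OF assms(1)])
  show "subgroup (H \<inter> K) (G\<lparr>carrier := H\<rparr>)"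
    using subgroup_incl[OF subgroups_Inter_pair[OF assms(1,2)] assms(1)] by blast
  show "finite ((#>) K ` carrier (G\<lparr>carrier := H\<rparr>))"
    using assms(3) subgroup.subset[OF assms(1)]
    by (auto simp: finite_index_def rcosets_eq_image intro: finite_subset[OF image_mono])
  fix g h assume gh: "g \<in> carrier (G\<lparr>carrier := H\<rparr>)" "h \<in> carrier (G\<lparr>carrier := H\<rparr>)"
    and eq: "K #> g = K #> h"
  then have "g \<in> carrier G" "h \<in> carrier G" using subgroup.subset[OF assms(1)] by auto
  then have "g \<otimes> inv h \<in> K"
    using coset_eq_imp_quotient_mem[OF _ _ _ _ eq] assms(2) subgroup.one_closed subgroup.subset by blast
  moreover have "g \<otimes> inv h \<in> H"
    using gh assms(1) by (simp add: subgroup.m_closed subgroup.m_inv_closed)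
  ultimately show "g \<otimes>\<^bsub>G\<lparr>carrier := H\<rparr>\<^esub> inv\<^bsub>G\<lparr>carrier := H\<rparr>\<^esub> h \<in> H \<inter> K"
    using gh m_inv_consistent[OF assms(1)] by simp
qed

text \<open>
  In the form used for orbits: a point whose stabiliser contains a set of finite index has a
  finite orbit.
\<close>

lemma finite_image_if_left_invariant:
  assumes "finite_index G H" "\<one> \<in> H" "H \<subseteq> carrier G"
    and "\<And>h g. \<lbrakk>h \<in> H; g \<in> carrier G\<rbrakk> \<Longrightarrow> f (h \<otimes> g) = f g"
  shows "finite (f ` carrier G)"
proof -
  have "f ` (H #> g) = {f g}" if "g \<in> carrier G" for g
    using assms(2,4) that by (force simp: r_coset_def)
  then have "f ` carrier G = (\<lambda>C. THE v. f ` C = {v}) ` (rcosets H)"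
    by (auto simp: rcosets_eq_image image_image)
  then show ?thesis using assms(1) by (simp add: finite_index_def)
qed

text \<open>
  Two powers of \<open>x\<close> lie in the same coset, and their quotient is a power of \<open>x\<close> in \<open>H\<close>.
\<close>

lemma power_mem_finite_index:
  assumes "finite_index G H" "\<one> \<in> H" "H \<subseteq> carrier G" "x \<in> carrier G"
  obtains n :: nat where "n > 0" "x [^] n \<in> H"
proof -
  have "range (\<lambda>n::nat. H #> x [^] n) \<subseteq> rcosets H"
    using assms by (auto simp: rcosets_eq_image)
  then have "finite (range (\<lambda>n::nat. H #> x [^] n))"
    using assms(1) finite_subset by (auto simp: finite_index_def)
  then have "\<not> inj (\<lambda>n::nat. H #> x [^] n)"
    using finite_imageD infinite_UNIV_nat by blast
  then obtain i j :: nat where ij: "i < j" "H #> x [^] j = H #> x [^] i"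
    unfolding inj_def by (metis nat_neq_iff)
  have "x [^] j \<otimes> inv (x [^] i) \<in> H"
    using coset_eq_imp_quotient_mem[OF assms(2,3) _ _ ij(2)] assms(4) by simp
  moreover have "x [^] j = x [^] (j - i) \<otimes> x [^] i"
    using ij(1) assms(4) by (simp add: nat_pow_mult)
  ultimately have "x [^] (j - i) \<in> H" using assms(4) by (simp add: m_assoc)
  then show ?thesis using ij(1) that[of "j - i"] by simp
qed

end

section \<open>Groups with a central subgroup of finite index\<close>

text \<open>
  The transfer homomorphism into a central subgroup \<open>Z\<close> of index \<open>n\<close>.  Choose representatives
  \<open>r C\<close> of the cosets and write \<open>s g = g (r (Z g))\<inverse>\<close>, an element of \<open>Z\<close> with
  \<open>s (z g) = z (s g)\<close>.  Then \<open>s (g x) (s g)\<inverse>\<close> depends only on the coset of \<open>g\<close> and on \<open>x\<close>, and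
  its product over all cosets is multiplicative in \<open>x\<close>, because right multiplication by \<open>x\<close>
  permutes the cosets.  For \<open>x \<in> Z\<close> every factor is \<open>x\<close>.
\<close>

lemma (in group) transfer_to_central_subgroup:
  assumes Z: "subgroup Z G" and central: "\<And>z g. \<lbrakk>z \<in> Z; g \<in> carrier G\<rbrakk> \<Longrightarrow> z \<otimes> g = g \<otimes> z"
    and fin: "finite_index G Z"
  obtains V and n :: nat where "V \<in> hom G (G\<lparr>carrier := Z\<rparr>)" "n > 0" "\<And>z. z \<in> Z \<Longrightarrow> V z = z [^] n"
proof -
  let ?K = "G\<lparr>carrier := Z\<rparr>"
  interpret Z: subgroup Z G by (rule Z)
  interpret K: comm_group ?K
    by (rule group.group_comm_groupI[OF subgroup_imp_group[OF Z]]) (use central in auto)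
  have finR: "finite (rcosets Z)" using fin by (simp add: finite_index_def)
  define r where "r = (\<lambda>C::'a set. SOME g. g \<in> C)"
  define s where "s = (\<lambda>g. g \<otimes> inv (r (Z #> g)))"
  define f where "f = (\<lambda>C x. s (r C \<otimes> x) \<otimes> inv (s (r C)))"
  define V where "V = (\<lambda>x. finprod ?K (\<lambda>C. f C x) (rcosets Z))"
  have r: "r (Z #> g) \<in> Z #> g" if "g \<in> carrier G" for g
    unfolding r_def using rcos_self[OF that Z] by (rule someI)
  have s: "s g \<in> Z" if g: "g \<in> carrier G" for g
  proof -
    have "Z #> g = Z #> r (Z #> g)" using repr_independence[OF r[OF g] g Z] .
    moreover have "r (Z #> g) \<in> carrier G"
      using r[OF g] g Z.subset r_coset_subset_G by blast
    ultimately show ?thesis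
      unfolding s_def using coset_eq_imp_quotient_mem[OF Z.one_closed Z.subset g] by metis
  qed
  have coset_mult: "Z #> (z \<otimes> g) = Z #> g" if "z \<in> Z" "g \<in> carrier G" for z g
    using repr_independence[of "z \<otimes> g" Z g] that Z rcosI[of z Z g] Z.subset by simp
  have s_mult: "s (z \<otimes> g) = z \<otimes> s g" if z: "z \<in> Z" and g: "g \<in> carrier G" for z g
  proof -
    have "r (Z #> g) \<in> carrier G"
      using r[OF g] g Z.subset r_coset_subset_G by blast
    then show ?thesis using z g Z.subset by (simp add: s_def coset_mult m_assoc subsetD)
  qed
  have f: "f (Z #> g) x = s (g \<otimes> x) \<otimes> inv (s g)"
    if g: "g \<in> carrier G" and x: "x \<in> carrier G" for g x
  proof -
    obtain z where z: "z \<in> Z" "r (Z #> g) = z \<otimes> g"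
      using r[OF g] by (auto simp: r_coset_def)
    have c: "z \<in> carrier G" "s (g \<otimes> x) \<in> carrier G" "s g \<in> carrier G"
      using z(1) s g x Z.subset by auto
    have "f (Z #> g) x = (z \<otimes> s (g \<otimes> x)) \<otimes> inv (z \<otimes> s g)"
      unfolding f_def z(2) using z(1) g x s_mult by (simp add: m_assoc c)
    also have "\<dots> = z \<otimes> (s (g \<otimes> x) \<otimes> inv (s g)) \<otimes> inv z"
      using c by (simp add: inv_mult_group m_assoc)
    also have "\<dots> = s (g \<otimes> x) \<otimes> inv (s g)"
      using c z(1) central[OF z(1), of "s (g \<otimes> x) \<otimes> inv (s g)"] by (simp add: m_assoc)
    finally show ?thesis .
  qed
  have fZ: "f C x \<in> Z" if "C \<in> rcosets Z" "x \<in> carrier G" for C x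
    using that f s Z.m_closed Z.m_inv_closed by (auto simp: rcosets_eq_image)
  have f_mult: "f C (x \<otimes> y) = f C x \<otimes> f (C #> x) y"
    if C: "C \<in> rcosets Z" and x: "x \<in> carrier G" and y: "y \<in> carrier G" for C x y
  proof -
    obtain g where g: "g \<in> carrier G" "C = Z #> g" using C by (auto simp: rcosets_eq_image)
    have c: "s g \<in> carrier G" "s (g \<otimes> x) \<in> carrier G" "s (g \<otimes> x \<otimes> y) \<in> carrier G"
      using s[THEN subsetD[OF Z.subset]] g x y by auto
    have "f C x \<otimes> f (C #> x) y = f (C #> x) y \<otimes> f C x"
      using central[OF fZ[OF C x]] fZ[of "C #> x" y] g x y Z.subset
      by (simp add: coset_mult_assoc rcosetsI subsetD)
    also have "\<dots> = (s (g \<otimes> x \<otimes> y) \<otimes> inv (s (g \<otimes> x))) \<otimes> (s (g \<otimes> x) \<otimes> inv (s g))"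
      using g x y f[of "g \<otimes> x" y] f[of g x] Z.subset by (simp add: coset_mult_assoc)
    also have "\<dots> = s (g \<otimes> x \<otimes> y) \<otimes> inv (s g)"
      using c by (simp add: m_assoc inv_solve_left')
    also have "\<dots> = f C (x \<otimes> y)" using g x y f[of g "x \<otimes> y"] by (simp add: m_assoc)
    finally show ?thesis by simp
  qed
  have "V \<in> hom G ?K"
  proof (rule homI)
    show "V x \<in> carrier ?K" if "x \<in> carrier G" for x
      unfolding V_def using fZ that by (intro K.finprod_closed) auto
  next
    fix x y assume x: "x \<in> carrier G" and y: "y \<in> carrier G"
    \<comment> \<open>Right multiplication by \<open>x\<close> permutes the cosets, so the second factor can be reindexed.\<close>
    have inj: "inj_on (\<lambda>C. C #> x) (rcosets Z)"
    proof (rule inj_on_inverseI)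
      fix C assume "C \<in> rcosets Z"
      then have "C \<subseteq> carrier G" using rcosets_part_G[OF Z] by blast
      then show "C #> x #> inv x = C" using x by (simp add: coset_mult_assoc)
    qed
    have "(\<lambda>C. C #> x) ` (rcosets Z) \<subseteq> rcosets Z"
      using x Z.subset by (auto simp: rcosets_eq_image coset_mult_assoc)
    then have img: "(\<lambda>C. C #> x) ` (rcosets Z) = rcosets Z"
      using endo_inj_surj[OF finR _ inj] by blast
    have shift: "C #> x \<in> rcosets Z" if "C \<in> rcosets Z" for C using img that by blast
    have "V (x \<otimes> y) = finprod ?K (\<lambda>C. f C x \<otimes>\<^bsub>?K\<^esub> f (C #> x) y) (rcosets Z)"
      unfolding V_def by (rule K.finprod_cong') (use fZ shift x y f_mult in auto)
    also have "\<dots> = V x \<otimes>\<^bsub>?K\<^esub> finprod ?K (\<lambda>C. f (C #> x) y) (rcosets Z)"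
      unfolding V_def by (rule K.finprod_multf) (use fZ shift x y in auto)
    also have "finprod ?K (\<lambda>C. f (C #> x) y) (rcosets Z) = V y"
      using K.finprod_reindex[OF _ inj, of "\<lambda>C. f C y"] img fZ y by (simp add: V_def Pi_def)
    finally show "V (x \<otimes> y) = V x \<otimes>\<^bsub>?K\<^esub> V y" .
  qed
  moreover have "card (rcosets Z) > 0"
    using finR Z.subgroup_in_rcosets[OF is_group] by (auto simp: card_gt_0_iff)
  moreover have "V z = z [^] card (rcosets Z)" if z: "z \<in> Z" for z
  proof -
    have "f C z = z" if C: "C \<in> rcosets Z" for C
    proof -
      obtain g where g: "g \<in> carrier G" "C = Z #> g" using C by (auto simp: rcosets_eq_image)
      have "s (g \<otimes> z) = z \<otimes> s g" using s_mult[OF z g(1)] central[OF z g(1)] by simp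
      then show ?thesis
        using g z f[of g z] s[OF g(1)] Z.subset by (simp add: m_assoc subsetD)
    qed
    then have "V z = finprod ?K (\<lambda>C. z) (rcosets Z)"
      unfolding V_def by (intro K.finprod_cong') (use z in auto)
    also have "\<dots> = z [^]\<^bsub>?K\<^esub> card (rcosets Z)" using z by (intro K.finprod_const) simp
    also have "\<dots> = z [^] card (rcosets Z)" by (simp add: nat_pow_consistent[symmetric])
    finally show ?thesis .
  qed
  ultimately show thesis using that by blast
qed

text \<open>
  The transfer \<open>V\<close> has abelian values, so it sends \<open>w = x y\<inverse>\<close> to an element of order dividing
  \<open>k\<close>.  A power \<open>w\<^sup>m\<close> lies in the central subgroup, where \<open>V\<close> is the \<open>n\<close>-th power map, hence
  \<open>w\<close> has finite order.
\<close>

lemma (in group) torsion_if_pow_eq_central: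
  assumes Z: "subgroup Z G" and central: "\<And>z g. \<lbrakk>z \<in> Z; g \<in> carrier G\<rbrakk> \<Longrightarrow> z \<otimes> g = g \<otimes> z"
    and fin: "finite_index G Z"
    and x: "x \<in> carrier G" and y: "y \<in> carrier G" and k: "k > 0" and eq: "x [^] (k::nat) = y [^] k"
  shows "x \<otimes> inv y \<in> torsion G"
proof -
  let ?K = "G\<lparr>carrier := Z\<rparr>"
  interpret Z: subgroup Z G by (rule Z)
  interpret K: comm_group ?K
    by (rule group.group_comm_groupI[OF subgroup_imp_group[OF Z]]) (use central in auto)
  obtain V and n :: nat where V: "V \<in> hom G ?K" "n > 0" "\<And>z. z \<in> Z \<Longrightarrow> V z = z [^] n"
    using transfer_to_central_subgroup[OF Z central fin] by blast
  interpret V: group_hom G ?K V by unfold_locales (rule V(1))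
  define w where "w = x \<otimes> inv y"
  have w: "w \<in> carrier G" using x y by (simp add: w_def)
  have [simp]: "a [^]\<^bsub>?K\<^esub> i = a [^] i" for a and i :: nat by (simp add: nat_pow_consistent[symmetric])
  have "V x [^]\<^bsub>?K\<^esub> k = V y [^]\<^bsub>?K\<^esub> k" using V.hom_nat_pow x y eq by metis
  moreover have "V w = V x \<otimes>\<^bsub>?K\<^esub> inv\<^bsub>?K\<^esub> V y" using x y by (simp add: w_def)
  ultimately have Vk: "V w [^]\<^bsub>?K\<^esub> k = \<one>\<^bsub>?K\<^esub>"
    using x y V.hom_closed K.pow_mult_distrib[OF K.m_comm, of "V x" "inv\<^bsub>?K\<^esub> V y" k]
      K.nat_pow_inv[of "V y" k] K.nat_pow_closed[of "V y" k] K.r_inv[of "V y [^]\<^bsub>?K\<^esub> k"]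
    by (metis K.inv_closed)
  obtain m :: nat where m: "m > 0" "w [^] m \<in> Z"
    using power_mem_finite_index[OF fin Z.one_closed Z.subset w] by blast
  have "w [^] (m * n * k) = ((w [^] m) [^] n) [^] k" using w by (simp add: nat_pow_pow mult.assoc)
  also have "\<dots> = V (w [^] m) [^]\<^bsub>?K\<^esub> k" using V(3)[OF m(2)] by simp
  also have "\<dots> = (V w [^]\<^bsub>?K\<^esub> k) [^]\<^bsub>?K\<^esub> m"
    using w V.hom_nat_pow[OF w] V.hom_closed[OF w] K.nat_pow_pow[of "V w"] by (metis mult.commute)
  also have "\<dots> = \<one>" using Vk K.nat_pow_one[of m] by simp
  finally show ?thesis
    using w V(2) m(1) k unfolding torsion_def w_def[symmetric]
    by (auto intro!: exI[of _ "m * n * k"])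
qed

section \<open>Torsion in FC-groups\<close>

text \<open>
  An FC-group is usually defined by finite conjugacy classes; the class of \<open>x\<close> has as many
  elements as the centraliser of \<open>x\<close> has cosets.
\<close>

locale fc_group = group +
  assumes finite_index_centraliser: "x \<in> carrier G \<Longrightarrow> finite_index G (centraliser G x)"

definition set_centraliser :: "('a, 'm) monoid_scheme \<Rightarrow> 'a set \<Rightarrow> 'a set" where
  "set_centraliser G S = {y \<in> carrier G. \<forall>x\<in>S. x \<otimes>\<^bsub>G\<^esub> y = y \<otimes>\<^bsub>G\<^esub> x}"

lemma (in group) subgroup_set_centraliser:
  assumes "S \<subseteq> carrier G"
  shows "subgroup (set_centraliser G S) G"
proof (rule subgroupI)
  show "set_centraliser G S \<subseteq> carrier G" by (auto simp: set_centraliser_def)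
  show "set_centraliser G S \<noteq> {}" using assms by (force simp: set_centraliser_def)
next
  fix a assume a: "a \<in> set_centraliser G S"
  have "x \<otimes> inv a = inv a \<otimes> x" if "x \<in> S" for x
  proof -
    have "x \<in> carrier G" "a \<in> carrier G" "x \<otimes> a = a \<otimes> x"
      using a that assms by (auto simp: set_centraliser_def)
    then show ?thesis by (metis inv_closed inv_solve_left inv_solve_right m_assoc m_closed)
  qed
  then show "inv a \<in> set_centraliser G S" using a by (auto simp: set_centraliser_def)
next
  fix a b assume ab: "a \<in> set_centraliser G S" "b \<in> set_centraliser G S"
  have "x \<otimes> (a \<otimes> b) = a \<otimes> b \<otimes> x" if "x \<in> S" for x
  proof -
    have "x \<in> carrier G" "a \<in> carrier G" "x \<otimes> a = a \<otimes> x" "b \<in> carrier G" "x \<otimes> b = b \<otimes> x"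
      using ab that assms by (auto simp: set_centraliser_def)
    then show ?thesis by (metis m_assoc)
  qed
  then show "a \<otimes> b \<in> set_centraliser G S" using ab by (auto simp: set_centraliser_def)
qed

context fc_group
begin

lemma finite_index_set_centraliser:
  assumes "finite S" "S \<subseteq> carrier G"
  shows "finite_index G (set_centraliser G S)"
  using assms
proof (induction S)
  case empty
  have "set_centraliser G {} = carrier G" by (simp add: set_centraliser_def)
  then show ?case
    using finite_indexI[OF subgroup_self, of "\<lambda>_. ()"] by simp
next
  case (insert x S)
  have single: "set_centraliser G {x} = centraliser G x"
    by (auto simp: set_centraliser_def centraliser_def)
  have "finite_index G (set_centraliser G {x} \<inter> set_centraliser G S)"
    using insert by (intro finite_index_Int subgroup_set_centraliser)
      (auto simp: single finite_index_centraliser)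
  also have "set_centraliser G {x} \<inter> set_centraliser G S = set_centraliser G (insert x S)"
    by (auto simp: set_centraliser_def)
  finally show ?case .
qed

text \<open>
  Statements about two elements \<open>x, y\<close> of an FC-group reduce to a group that is finite over its
  centre.  With \<open>D\<close> the centraliser of \<open>{x, y}\<close>, the centraliser \<open>H\<close> of \<open>D\<close> contains \<open>x\<close> and
  \<open>y\<close>, and \<open>H \<inter> D\<close> is central and of finite index in \<open>H\<close>.
\<close>

lemma torsion_if_pow_eq:
  assumes x: "x \<in> carrier G" and y: "y \<in> carrier G"
    and k: "k > 0" and eq: "x [^] (k::nat) = y [^] k"
  shows "x \<otimes> inv y \<in> torsion G"
proof -
  define D where "D = set_centraliser G {x, y}"
  define H where "H = set_centraliser G D"
  let ?H = "G\<lparr>carrier := H\<rparr>"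
  have D: "subgroup D G" "finite_index G D"
    unfolding D_def using x y by (auto intro!: subgroup_set_centraliser finite_index_set_centraliser)
  have H: "subgroup H G" unfolding H_def by (rule subgroup_set_centraliser[OF subgroup.subset[OF D(1)]])
  interpret H: group ?H by (rule subgroup_imp_group[OF H])
  have xy: "x \<in> H" "y \<in> H" using x y by (auto simp: H_def D_def set_centraliser_def)
  have "x \<otimes>\<^bsub>?H\<^esub> inv\<^bsub>?H\<^esub> y \<in> torsion ?H"
  proof (rule H.torsion_if_pow_eq_central[of "H \<inter> D", OF _ _ _ _ _ k])
    show "subgroup (H \<inter> D) ?H"
      using subgroup_incl[OF subgroups_Inter_pair[OF H D(1)] H] by blast
    show "finite_index ?H (H \<inter> D)" by (rule finite_index_restrict[OF H D])
    show "z \<otimes>\<^bsub>?H\<^esub> g = g \<otimes>\<^bsub>?H\<^esub> z" if "z \<in> H \<inter> D" "g \<in> carrier ?H" for z g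
      using that by (simp add: H_def set_centraliser_def)
    show "x [^]\<^bsub>?H\<^esub> k = y [^]\<^bsub>?H\<^esub> k" using eq by (simp add: nat_pow_consistent[symmetric])
  qed (use xy in auto)
  then show ?thesis
    using xy m_inv_consistent[OF H] subgroup.subset[OF H]
    by (auto simp: torsion_def nat_pow_consistent[symmetric])
qed

end

lemma (in group) torsion_of_power:
  assumes "x \<in> carrier G" "n > 0" "x [^] (n::nat) \<in> torsion G"
  shows "x \<in> torsion G"
proof -
  obtain m :: nat where "m > 0" "(x [^] n) [^] m = \<one>" using assms(3) by (auto simp: torsion_def)
  then show ?thesis
    using assms by (auto simp: torsion_def nat_pow_pow intro!: exI[of _ "n * m"])
qed

lemma (in group) torsion_inv: "x \<in> torsion G \<Longrightarrow> inv x \<in> torsion G"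
  by (auto simp: torsion_def nat_pow_inv)

context fc_group
begin

lemma torsion_quotient:
  assumes "x \<in> torsion G" "y \<in> torsion G"
  shows "x \<otimes> inv y \<in> torsion G"
proof -
  obtain m n :: nat where "m > 0" "x [^] m = \<one>" "n > 0" "y [^] n = \<one>"
    "x \<in> carrier G" "y \<in> carrier G"
    using assms by (auto simp: torsion_def)
  moreover from this have "x [^] (m * n) = \<one>" "y [^] (m * n) = \<one>"
    by (metis nat_pow_pow nat_pow_one, metis nat_pow_pow nat_pow_one mult.commute)
  ultimately show ?thesis by (intro torsion_if_pow_eq[of x y "m * n"]) auto
qed

lemma torsion_normal: "torsion G \<lhd> G"
proof -
  have "subgroup (torsion G) G"
  proof (rule subgroupI)
    show "torsion G \<subseteq> carrier G" by (auto simp: torsion_def)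
    show "torsion G \<noteq> {}" by (auto simp: torsion_def intro!: exI[of _ "\<one>"] exI[of _ "Suc 0"])
    show "inv a \<in> torsion G" if "a \<in> torsion G" for a by (rule torsion_inv[OF that])
    show "a \<otimes> b \<in> torsion G" if "a \<in> torsion G" "b \<in> torsion G" for a b
      using torsion_quotient[OF that(1) torsion_inv[OF that(2)]] that by (simp add: torsion_def)
  qed
  moreover have "x \<otimes> h \<otimes> inv x \<in> torsion G" if x: "x \<in> carrier G" and h: "h \<in> torsion G" for x h
  proof -
    obtain n :: nat where n: "n > 0" "h [^] n = \<one>" "h \<in> carrier G" using h by (auto simp: torsion_def)
    have "(x \<otimes> h \<otimes> inv x) [^] k = x \<otimes> h [^] k \<otimes> inv x" for k :: nat
      using x n(3) by (induction k) (simp_all add: m_assoc inv_solve_left')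
    then show ?thesis using x n by (auto simp: torsion_def intro!: exI[of _ n])
  qed
  ultimately show ?thesis by (simp add: normal_inv_iff)
qed

end

section \<open>Finiteness of torsion\<close>

text \<open>
  Two elements of \<open>T\<close> in the same coset of \<open>H\<close> differ by an element of \<open>T \<inter> H\<close>.
\<close>

lemma (in group) finite_subgroup_if_covered:
  assumes T: "subgroup T G" and H: "subgroup H G" and fin: "finite (T \<inter> H)"
    and R: "finite R" "R \<subseteq> carrier G"
    and cover: "\<And>t. t \<in> T \<Longrightarrow> \<exists>h\<in>H. \<exists>r\<in>R. t = h \<otimes> r"
  shows "finite T"
proof -
  have "finite (T \<inter> (H #> r))" if r: "r \<in> R" for r
  proof (cases "T \<inter> (H #> r) = {}")
    case False
    then obtain t where t: "t \<in> T" "t \<in> H #> r" by blast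
    have "T \<inter> (H #> r) \<subseteq> (\<lambda>u. u \<otimes> t) ` (T \<inter> H)"
    proof
      fix u assume u: "u \<in> T \<inter> (H #> r)"
      have c: "u \<in> carrier G" "t \<in> carrier G" using u t T subgroup.subset by blast+
      have "H #> u = H #> t"
        using repr_independence[OF _ _ H] u t r R by (metis IntD2 subsetD)
      then have "u \<otimes> inv t \<in> H"
        using coset_eq_imp_quotient_mem c H subgroup.one_closed subgroup.subset by metis
      moreover have "u \<otimes> inv t \<in> T"
        using u t T subgroup.m_closed subgroup.m_inv_closed by (metis IntD1)
      moreover have "u = u \<otimes> inv t \<otimes> t" using c by (simp add: m_assoc)
      ultimately show "u \<in> (\<lambda>u. u \<otimes> t) ` (T \<inter> H)" by blast
    qed
    then show ?thesis using fin finite_surj by blast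
  qed simp
  moreover have "T \<subseteq> (\<Union>r\<in>R. T \<inter> (H #> r))"
    using cover by (fastforce simp: r_coset_def)
  ultimately show ?thesis using R(1) finite_subset by blast
qed

lemma (in comm_group) is_fc_group: "fc_group G"
proof
  fix x assume "x \<in> carrier G"
  then have "centraliser G x = carrier G" by (auto simp: centraliser_def m_comm)
  then show "finite_index G (centraliser G x)"
    using finite_indexI[OF subgroup_self, of "\<lambda>_. ()"] by simp
qed

lemma (in comm_group) generate_insert_decompose:
  assumes S: "S \<subseteq> carrier G" and s: "s \<in> carrier G" and w: "w \<in> generate G (insert s S)"
  shows "\<exists>a\<in>generate G S. \<exists>j::int. w = a \<otimes> s [^] j"
  using w
proof induction
  case one
  have "\<one> = \<one> \<otimes> s [^] (0::int)" by simp
  then show ?case using generate.one by blast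
next
  case (incl h)
  then consider "h = s" | "h \<in> S" by blast
  then show ?case
  proof cases
    case 1
    then have "h = \<one> \<otimes> s [^] (1::int)" using s by simp
    then show ?thesis using generate.one by blast
  next
    case 2
    then have "h = h \<otimes> s [^] (0::int)" using S by auto
    then show ?thesis using generate.incl[OF 2] by blast
  qed
next
  case (inv h)
  then consider "h = s" | "h \<in> S" by blast
  then show ?case
  proof cases
    case 1
    then have "inv h = \<one> \<otimes> s [^] (-1::int)" using s by (simp add: int_pow_neg)
    then show ?thesis using generate.one by blast
  next
    case 2
    then have "inv h = inv h \<otimes> s [^] (0::int)" using S by auto
    then show ?thesis using generate.inv[OF 2] by blast
  qed
next
  case (eng g h)
  then obtain a i b j where ab: "a \<in> generate G S" "b \<in> generate G S"
    and gh: "g = a \<otimes> s [^] (i::int)" "h = b \<otimes> s [^] (j::int)" by blast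
  have "a \<in> carrier G" "b \<in> carrier G" "s [^] i \<in> carrier G" "s [^] j \<in> carrier G"
    using ab S s generate_in_carrier by auto
  then have "g \<otimes> h = (a \<otimes> b) \<otimes> (s [^] i \<otimes> s [^] j)"
    unfolding gh by (simp only: m_ac m_closed)
  then have "g \<otimes> h = (a \<otimes> b) \<otimes> s [^] (i + j)"
    using s by (simp add: int_pow_mult)
  then show ?case using generate.eng[OF ab] by blast
qed

text \<open>
  Induction on the generators.  When a generator \<open>s\<close> is added to \<open>A\<close>, either \<open>s\<^sup>d \<in> A\<close> for some
  \<open>d > 0\<close>, and finitely many cosets of \<open>A\<close> cover the larger group; or no positive power of \<open>s\<close>
  lies in \<open>A\<close>, and \<open>a s\<^sup>j\<close> with \<open>a \<in> A\<close> can only have finite order if \<open>j = 0\<close>.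
\<close>

lemma (in comm_group) finite_torsion_generate:
  assumes "finite S" "S \<subseteq> carrier G"
  shows "finite (torsion G \<inter> generate G S)"
  using assms
proof (induction S)
  case empty
  have "generate G {} = {\<one>}" by (rule generate_empty)
  then show ?case by simp
next
  case (insert s S)
  interpret fc_group G by (rule is_fc_group)
  let ?A = "generate G S" and ?A' = "generate G (insert s S)"
  have S: "S \<subseteq> carrier G" and s: "s \<in> carrier G" using insert by auto
  have A: "subgroup ?A G" and A': "subgroup ?A' G" using insert generate_is_subgroup by auto
  have T: "subgroup (torsion G) G" using torsion_normal normal_imp_subgroup by blast
  have sub: "?A \<subseteq> ?A'" by (rule mono_generate) auto
  have fin: "finite (torsion G \<inter> ?A)" using insert by simp
  obtain R where R: "finite R" "R \<subseteq> carrier G"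
    "\<And>t. t \<in> torsion G \<inter> ?A' \<Longrightarrow> \<exists>h\<in>?A. \<exists>r\<in>R. t = h \<otimes> r"
  proof (cases "\<exists>d::nat. d > 0 \<and> s [^] d \<in> ?A")
    case True
    then obtain d :: nat where d: "d > 0" "s [^] d \<in> ?A" by blast
    show thesis
    proof (rule that[of "(\<lambda>i::int. s [^] i) ` {0..<int d}"])
      fix t assume "t \<in> torsion G \<inter> ?A'"
      then obtain a j where a: "a \<in> ?A" "t = a \<otimes> s [^] (j::int)"
        using generate_insert_decompose[OF S s] by blast
      have "a \<in> carrier G" using a S generate_in_carrier by auto
      moreover have "s [^] j = (s [^] int d) [^] (j div int d) \<otimes> s [^] (j mod int d)"
        using s by (simp add: int_pow_pow int_pow_mult[symmetric])
      ultimately have "t = (a \<otimes> (s [^] int d) [^] (j div int d)) \<otimes> s [^] (j mod int d)"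
        using a s by (simp add: m_assoc)
      moreover have "(s [^] int d) [^] (j div int d) \<in> ?A"
        using subgroup_int_pow_closed[OF A] d(2) by (simp add: int_pow_int)
      ultimately show "\<exists>h\<in>?A. \<exists>r\<in>(\<lambda>i::int. s [^] i) ` {0..<int d}. t = h \<otimes> r"
        using a(1) d(1) subgroup.m_closed[OF A]
        by (intro bexI[of _ "a \<otimes> (s [^] int d) [^] (j div int d)"]
            bexI[of _ "s [^] (j mod int d)"]) auto
    qed (use s in auto)
  next
    case False
    show thesis
    proof (rule that[of "{\<one>}"])
      fix t assume t: "t \<in> torsion G \<inter> ?A'"
      then obtain a j where a: "a \<in> ?A" "t = a \<otimes> s [^] (j::int)"
        using generate_insert_decompose[OF S s] by blast
      have ac: "a \<in> carrier G" using a S generate_in_carrier by auto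
      obtain n :: nat where n: "n > 0" "t [^] n = \<one>" using t by (auto simp: torsion_def)
      have "\<one> = a [^] int n \<otimes> s [^] (j * int n)"
        using n(2) ac s by (simp add: a(2) int_pow_int[symmetric] int_pow_distrib int_pow_pow)
      then have "s [^] (j * int n) = inv (a [^] int n)"
        using ac s by (metis int_pow_closed inv_equality inv_inv inv_closed)
      then have mem: "s [^] (j * int n) \<in> ?A"
        using a(1) A subgroup_int_pow_closed subgroup.m_inv_closed by metis
      have "s [^] (nat \<bar>j\<bar> * n) \<in> ?A"
      proof (cases "j \<ge> 0")
        case True
        then have "j * int n = int (nat \<bar>j\<bar> * n)" by simp
        then show ?thesis using mem by (metis int_pow_int)
      next
        case False
        then have "- (j * int n) = int (nat \<bar>j\<bar> * n)" by simp
        then show ?thesis using subgroup.m_inv_closed[OF A mem] s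
          by (metis int_pow_int int_pow_neg)
      qed
      then have "j = 0" using False n(1) by (metis mult_pos_pos nat_0_iff nat_less_eq_zless
            not_gr_zero abs_le_zero_iff)
      then show "\<exists>h\<in>?A. \<exists>r\<in>{\<one>}. t = h \<otimes> r"
      proof -
        have "t = a \<otimes> \<one>" using a(2) ac \<open>j = 0\<close> by simp
        then show ?thesis using a(1) by blast
      qed
    qed auto
  qed
  show ?case
    by (rule finite_subgroup_if_covered[OF subgroups_Inter_pair[OF T A'] A finite_subset[OF _ fin] R]) auto
qed

text \<open>
  The centraliser \<open>D\<close> of the generators is the centre and has finite index.  As in Schreier's
  lemma, the elements \<open>r e r'\<inverse>\<close> of \<open>D\<close> with \<open>r, r'\<close> representatives of the cosets of \<open>D\<close> and
  \<open>e\<close> a generator or the inverse of one form a finite set \<open>S\<close>, and the group is covered by finitely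
  many cosets of the abelian group generated by \<open>S\<close>, whose torsion is finite.
\<close>

lemma (in fc_group) finite_torsion_if_finitely_generated:
  assumes E: "finite E" "E \<subseteq> carrier G" and gen: "generate G E = carrier G"
  shows "finite (torsion G)"
proof -
  define D where "D = set_centraliser G E"
  have D: "subgroup D G" "finite_index G D"
    unfolding D_def using E by (auto intro!: subgroup_set_centraliser finite_index_set_centraliser)
  have D_sub: "D \<subseteq> carrier G" using subgroup.subset[OF D(1)] .
  have "generate G E \<subseteq> set_centraliser G D"
    using E D_sub by (intro generate_subgroup_incl subgroup_set_centraliser)
      (auto simp: D_def set_centraliser_def)
  then have central: "d \<otimes> g = g \<otimes> d" if "d \<in> D" "g \<in> carrier G" for d g
    using that gen by (auto simp: set_centraliser_def)
  obtain R0 where R0: "finite R0" "R0 \<subseteq> carrier G" "\<And>g. g \<in> carrier G \<Longrightarrow> \<exists>r\<in>R0. g \<otimes> inv r \<in> D"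
  proof
    let ?c = "\<lambda>C. SOME g. g \<in> C"
    have c: "?c (D #> g) \<in> D #> g" if "g \<in> carrier G" for g
      by (rule someI, rule rcos_self[OF that D(1)])
    show "finite (?c ` (rcosets D))" using D(2) by (simp add: finite_index_def)
    show sub: "?c ` (rcosets D) \<subseteq> carrier G"
    proof
      fix x assume "x \<in> ?c ` (rcosets D)"
      then obtain g where g: "g \<in> carrier G" "x = ?c (D #> g)" by (auto simp: rcosets_eq_image)
      then have "x \<in> D #> g" using c by simp
      then show "x \<in> carrier G" using r_coset_subset_G[OF D_sub g(1)] by blast
    qed
    show "\<exists>r\<in>?c ` (rcosets D). g \<otimes> inv r \<in> D" if g: "g \<in> carrier G" for g
    proof (rule bexI)
      show "?c (D #> g) \<in> ?c ` (rcosets D)" using g by (auto simp: rcosets_eq_image)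
      then have "?c (D #> g) \<in> carrier G" using sub by blast
      then show "g \<otimes> inv ?c (D #> g) \<in> D"
        using coset_eq_imp_quotient_mem[OF subgroup.one_closed[OF D(1)] D_sub g]
          repr_independence[OF c[OF g] g D(1)] by blast
    qed
  qed
  \<comment> \<open>With the identity among the representatives, the set covered below contains the identity.\<close>
  define R where "R = insert \<one> R0"
  have R: "finite R" "R \<subseteq> carrier G" "\<And>g. g \<in> carrier G \<Longrightarrow> \<exists>r\<in>R. g \<otimes> inv r \<in> D"
    using R0 by (auto simp: R_def)
  define F where "F = E \<union> (\<lambda>e. inv e) ` E"
  define S where "S = (\<lambda>(r, e, r'). r \<otimes> e \<otimes> inv r') ` (R \<times> F \<times> R) \<inter> D"
  have S: "finite S" "S \<subseteq> D" using R(1) E(1) by (auto simp: S_def F_def)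
  have F: "F \<subseteq> carrier G" using E by (auto simp: F_def)
  have gS: "subgroup (generate G S) G" using S D_sub by (intro generate_is_subgroup) auto
  let ?W = "generate G S <#> R"
  \<comment> \<open>The set \<open>?W\<close> contains the identity and is closed under right multiplication by generators,
    so it is the whole group.\<close>
  have step: "w \<otimes> e \<in> ?W" if w: "w \<in> ?W" and e: "e \<in> F" for w e
  proof -
    obtain h r where h: "h \<in> generate G S" "r \<in> R" "w = h \<otimes> r" using w by (auto simp: set_mult_def)
    have c: "h \<in> carrier G" "r \<in> carrier G" "e \<in> carrier G"
      using h gS subgroup.subset R e F by blast+
    obtain r' where r': "r' \<in> R" "r \<otimes> e \<otimes> inv r' \<in> D" using R(3)[of "r \<otimes> e"] c by auto
    have "r \<otimes> e \<otimes> inv r' \<in> (\<lambda>(r, e, r'). r \<otimes> e \<otimes> inv r') ` (R \<times> F \<times> R)"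
      by (rule image_eqI[of _ _ "(r, e, r')"]) (use h e r' in auto)
    then have "r \<otimes> e \<otimes> inv r' \<in> S" using r'(2) by (simp add: S_def)
    then have "h \<otimes> (r \<otimes> e \<otimes> inv r') \<in> generate G S"
      by (rule generate.eng[OF h(1) generate.incl])
    moreover have "w \<otimes> e = h \<otimes> (r \<otimes> e \<otimes> inv r') \<otimes> r'"
      using c r' R(2) by (auto simp: h(3) m_assoc)
    ultimately show ?thesis using r' by (auto simp: set_mult_def)
  qed
  have W_sub: "?W \<subseteq> carrier G"
    using gS R(2) subgroup.subset setmult_subset_G by blast
  have "w \<otimes> g \<in> ?W" if "g \<in> generate G E" "w \<in> ?W" for g w
    using that
  proof (induction arbitrary: w)
    case one
    then show ?case using W_sub r_one by (simp add: subsetD)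
  next
    case (incl e)
    then show ?case using step[of w e] by (simp add: F_def)
  next
    case (inv e)
    then show ?case using step[of w "inv e"] by (simp add: F_def)
  next
    case (eng g h)
    have "g \<in> carrier G" "h \<in> carrier G" "w \<in> carrier G"
      using eng generate_in_carrier[OF E(2)] W_sub by auto
    then have "w \<otimes> (g \<otimes> h) = (w \<otimes> g) \<otimes> h" by (simp add: m_assoc)
    then show ?case using eng.IH(2)[OF eng.IH(1)[OF eng.prems]] by simp
  qed
  moreover have "\<one> \<otimes> \<one> \<in> ?W"
    unfolding set_mult_def R_def using generate.one[of G S] by blast
  ultimately have W: "(\<one> \<otimes> \<one>) \<otimes> t \<in> ?W" if "t \<in> carrier G" for t
    using that gen by blast
  have "t \<in> ?W" if "t \<in> carrier G" for t using W[OF that] that by simp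
  then have cover: "\<exists>h\<in>generate G S. \<exists>r\<in>R. t = h \<otimes> r" if "t \<in> torsion G" for t
    using that by (auto simp: torsion_def set_mult_def)
  let ?D = "G\<lparr>carrier := D\<rparr>"
  interpret D: comm_group ?D
    by (rule group.group_comm_groupI[OF subgroup_imp_group[OF D(1)]]) (use central D_sub in auto)
  have gSD: "generate ?D S = generate G S" by (rule generate_consistent[OF S(2) D(1)])
  have "finite (torsion ?D \<inter> generate G S)"
    using D.finite_torsion_generate[of S] S gSD by simp
  moreover have "generate G S \<subseteq> D" using S(2) D(1) by (rule generate_subgroup_incl)
  then have "torsion G \<inter> generate G S \<subseteq> torsion ?D \<inter> generate G S"
    by (auto simp: torsion_def nat_pow_consistent[symmetric])
  ultimately have "finite (torsion G \<inter> generate G S)" by (rule rev_finite_subset)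
  then show ?thesis
    using finite_subgroup_if_covered[OF normal_imp_subgroup[OF torsion_normal] gS _ R(1,2) cover] by blast
qed

section \<open>The action lambda of a skew brace\<close>

context skew_brace
begin

lemma lam_plus:
  assumes "a \<in> carrier B" "b \<in> carrier B" "c \<in> carrier B"
  shows "lam B a (b \<oplus> c) = lam B a b \<oplus> lam B a c"
  using assms by (simp add: lam_def brace_eq a_minus_def plus_assoc)

lemma lam_one: "b \<in> carrier B \<Longrightarrow> lam B \<one> b = b"
  using times_eq_plus_lam[of \<one> b] by (simp add: one_eq_zero[symmetric]) (simp add: one_eq_zero)

lemma lam_times:
  assumes a: "a \<in> carrier B" and b: "b \<in> carrier B" and c: "c \<in> carrier B"
  shows "lam B (a \<otimes> b) c = lam B a (lam B b c)"
proof -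
  have "(a \<otimes> b) \<oplus> lam B (a \<otimes> b) c = a \<otimes> (b \<oplus> lam B b c)"
    using assms by (simp add: times_eq_plus_lam[symmetric] m_assoc)
  also have "\<dots> = (a \<otimes> b) \<oplus> lam B a (lam B b c)"
    using assms lam_def[of B a] by (simp add: brace_eq a_minus_def plus_assoc)
  finally show ?thesis using assms by (metis lam_closed m_closed plus_minus_cancel(2))
qed

lemma lam_group_hom:
  assumes "a \<in> carrier B"
  shows "group_hom (add_monoid B) (add_monoid B) (lam B a)"
  by unfold_locales (use assms lam_plus in \<open>auto simp: hom_def\<close>)

lemma lam_zero: "a \<in> carrier B \<Longrightarrow> lam B a \<zero> = \<zero>"
  using group_hom.hom_one[OF lam_group_hom] by simp

lemma lam_neg: "\<lbrakk>a \<in> carrier B; b \<in> carrier B\<rbrakk> \<Longrightarrow> lam B a (\<ominus> b) = \<ominus> lam B a b"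
  using group_hom.hom_inv[OF lam_group_hom] by (simp add: a_inv_def)

lemma star_eq_zero_iff:
  assumes "a \<in> carrier B" "b \<in> carrier B"
  shows "star B a b = \<zero> \<longleftrightarrow> lam B a b = b"
proof -
  have "star B a b = lam B a b \<oplus> \<ominus> b" by (simp add: star_def a_minus_def)
  moreover have "lam B a b = (lam B a b \<oplus> \<ominus> b) \<oplus> b" using assms by (simp add: plus_assoc)
  ultimately show ?thesis using assms by (metis plus_simps(1,4))
qed

lemma Fix_r_iff: "x \<in> carrier B \<Longrightarrow> b \<in> Fix_r B x \<longleftrightarrow> b \<in> carrier B \<and> lam B x b = b"
  by (auto simp: Fix_r_def star_eq_zero_iff)

lemma Fix_l_iff: "x \<in> carrier B \<Longrightarrow> b \<in> Fix_l B x \<longleftrightarrow> b \<in> carrier B \<and> lam B b x = x"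
  by (auto simp: Fix_l_def star_eq_zero_iff)

lemma zero_mem_fixed:
  assumes "x \<in> carrier B"
  shows "\<zero> \<in> Fix_r B x \<inter> centraliser (add_monoid B) x" "\<one> \<in> Fix_l B x \<inter> centraliser B x"
  using assms by (auto simp: Fix_r_iff Fix_l_iff centraliser_def lam_zero lam_one)

text \<open>
  A \<open>\<lambda>\<close>-invariant additive subgroup is closed under \<open>\<circ>\<close> because
  \<open>x \<circ> y = x + \<lambda>\<^sub>x(y)\<close>, and the \<open>\<circ>\<close>-inverse of \<open>x\<close> is \<open>- \<lambda>\<^sub>u(x)\<close> with \<open>u\<close> that inverse.
\<close>

lemma left_ideal_imp_sub_skew_brace:
  assumes M: "subgroup M (add_monoid B)"
    and lam: "\<And>a b. \<lbrakk>a \<in> carrier B; b \<in> M\<rbrakk> \<Longrightarrow> lam B a b \<in> M"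
  shows "sub_skew_brace M B"
proof -
  have sub: "M \<subseteq> carrier B" using subgroup.subset[OF M] by simp
  have plus: "x \<oplus> y \<in> M" if "x \<in> M" "y \<in> M" for x y
    using subgroup.m_closed[OF M that] by simp
  have neg: "\<ominus> x \<in> M" if "x \<in> M" for x
    using subgroup.m_inv_closed[OF M that] by (simp add: a_inv_def)
  have "subgroup M B"
  proof (rule subgroupI)
    show "M \<noteq> {}" using subgroup.one_closed[OF M] by blast
  next
    fix x assume x: "x \<in> M"
    have "inv x \<oplus> lam B (inv x) x = \<zero>"
      using x sub by (simp add: times_eq_plus_lam[symmetric] one_eq_zero subsetD)
    then have "inv x = \<ominus> lam B (inv x) x"
      using x sub add.inv_equality[of "inv x" "lam B (inv x) x"] by (auto simp: a_inv_def)
    then show "inv x \<in> M" using neg[OF lam[of "inv x" x]] x sub by auto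
  next
    fix x y assume xy: "x \<in> M" "y \<in> M"
    then show "x \<otimes> y \<in> M" using sub plus lam[of x y] by (subst times_eq_plus_lam) auto
  qed (rule sub)
  then show ?thesis using M by (simp add: sub_skew_brace_def)
qed

end

section \<open>Skew braces with property (S)\<close>

locale skew_brace_S = skew_brace +
  assumes property_S: "property_S B"
begin

lemma fix_r_index:
  "x \<in> carrier B \<Longrightarrow> finite_index (add_monoid B) (Fix_r B x \<inter> centraliser (add_monoid B) x)"
  using property_S by (simp add: property_S_def property_s_def)

lemma fix_l_index: "x \<in> carrier B \<Longrightarrow> finite_index B (Fix_l B x \<inter> centraliser B x)"
  using property_S by (simp add: property_S_def property_s_def)

sublocale add: fc_group "add_monoid B"
proof
  fix x assume "x \<in> carrier (add_monoid B)"
  then have x: "x \<in> carrier B" by simp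
  have "centraliser (add_monoid B) x = set_centraliser (add_monoid B) {x}"
    by (auto simp: centraliser_def set_centraliser_def)
  then have "subgroup (centraliser (add_monoid B) x) (add_monoid B)"
    using add.subgroup_set_centraliser[of "{x}"] x by simp
  then show "finite_index (add_monoid B) (centraliser (add_monoid B) x)"
    using add.finite_index_mono[OF fix_r_index[OF x]] zero_mem_fixed[OF x] by simp
qed

sublocale fc_group B
proof
  fix x assume x: "x \<in> carrier B"
  have "centraliser B x = set_centraliser B {x}"
    by (auto simp: centraliser_def set_centraliser_def)
  then have "subgroup (centraliser B x) B"
    using subgroup_set_centraliser[of "{x}"] x by simp
  then show "finite_index B (centraliser B x)"
    using finite_index_mono[OF fix_l_index[OF x]] zero_mem_fixed[OF x] by simp
qed

abbreviation multiple (infixl "\<cdot>" 75) where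
  "multiple x n \<equiv> x [^]\<^bsub>add_monoid B\<^esub> (n::nat)"

lemma T_plus_subset: "T_plus B \<subseteq> carrier B"
  by (auto simp: T_plus_def torsion_def)

lemma T_plus_normal: "T_plus B \<lhd> add_monoid B"
  unfolding T_plus_def by (rule add.torsion_normal)

lemma T_plus_closed:
  shows "\<And>x y. \<lbrakk>x \<in> T_plus B; y \<in> T_plus B\<rbrakk> \<Longrightarrow> x \<oplus> y \<in> T_plus B"
    and "\<And>x. x \<in> T_plus B \<Longrightarrow> \<ominus> x \<in> T_plus B"
  using subgroup.m_closed[OF normal_imp_subgroup[OF T_plus_normal]]
    subgroup.m_inv_closed[OF normal_imp_subgroup[OF T_plus_normal]] by (auto simp: a_inv_def)

lemma lam_T_plus:
  assumes "a \<in> carrier B" "x \<in> T_plus B"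
  shows "lam B a x \<in> T_plus B"
proof -
  obtain n :: nat where n: "n > 0" "x \<cdot> n = \<zero>" "x \<in> carrier B"
    using assms(2) by (auto simp: T_plus_def torsion_def)
  have "lam B a x \<cdot> n = \<zero>"
    using group_hom.hom_nat_pow[OF lam_group_hom[OF assms(1)], of x n] n assms(1)
    by (simp add: lam_zero)
  then show ?thesis using n assms(1) by (auto simp: T_plus_def torsion_def)
qed

text \<open>
  This says that \<open>\<lambda>\<close> acts trivially modulo \<open>T\<^sub>+\<close>, where the two operations then agree.  Some
  positive multiple \<open>n b\<close> is fixed by \<open>\<lambda>\<^sub>a\<close>; thus \<open>n \<lambda>\<^sub>a(b) = n b\<close>, and equal multiples in an
  FC-group differ by torsion.
\<close>

lemma star_mem_T_plus:
  assumes a: "a \<in> carrier B" and b: "b \<in> carrier B"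
  shows "star B a b \<in> T_plus B"
proof -
  obtain n :: nat where n: "n > 0" "b \<cdot> n \<in> Fix_r B a \<inter> centraliser (add_monoid B) a"
    using add.power_mem_finite_index[OF fix_r_index[OF a], of b] zero_mem_fixed[OF a] b
    by (auto simp: centraliser_def)
  then have "lam B a (b \<cdot> n) = b \<cdot> n" using a by (simp add: Fix_r_iff)
  then have "lam B a b \<cdot> n = b \<cdot> n"
    using group_hom.hom_nat_pow[OF lam_group_hom[OF a], of b n] b by simp
  then show ?thesis
    using add.torsion_if_pow_eq[of "lam B a b" b n] n a b
    by (simp add: T_plus_def star_def a_minus_def a_inv_def)
qed

text \<open>
  The error terms \<open>x\<^sup>i * x\<close> are torsion elements.  They are collected on the left by conjugation,
  which stays inside \<open>T\<^sub>+\<close>.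
\<close>

lemma circ_pow_congruent_multiple:
  assumes x: "x \<in> carrier B"
  shows "\<exists>t \<in> T_plus B. x [^] n = t \<oplus> x \<cdot> n"
proof (induction n)
  case 0
  show ?case using subgroup.one_closed[OF normal_imp_subgroup[OF T_plus_normal]]
    by (intro bexI[of _ \<zero>]) (auto simp: one_eq_zero)
next
  case (Suc n)
  define p where "p = x [^] n"
  obtain t where t: "t \<in> T_plus B" "p = t \<oplus> x \<cdot> n" using Suc by (auto simp: p_def)
  define u where "u = star B p x"
  have p: "p \<in> carrier B" using x by (simp add: p_def)
  have u: "u \<in> T_plus B" using star_mem_T_plus[OF p x] by (simp add: u_def)
  have c: "t \<in> carrier B" "u \<in> carrier B" "x \<cdot> n \<in> carrier B"
    using t u T_plus_subset add.nat_pow_closed[of x n] x by auto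
  define v where "v = x \<cdot> n \<oplus> u \<oplus> \<ominus> (x \<cdot> n)"
  have v: "v \<in> T_plus B"
    using normal.inv_op_closed2[OF T_plus_normal, of "x \<cdot> n" u] c u by (simp add: v_def a_inv_def)
  have vc: "v \<in> carrier B" using v T_plus_subset by blast
  have "lam B p x = u \<oplus> x"
    using p x by (simp add: u_def star_def a_minus_def plus_assoc)
  moreover have "x \<cdot> n \<oplus> u = v \<oplus> x \<cdot> n" using c by (simp add: v_def plus_assoc)
  ultimately have "p \<otimes> x = (t \<oplus> v) \<oplus> (x \<cdot> n \<oplus> x)"
    using p x c vc t(2) by (simp add: times_eq_plus_lam) (metis plus_assoc plus_closed)
  then show ?case using T_plus_closed(1)[OF t(1) v] x by (auto simp: p_def)
qed

lemma T_circ_subset_T_plus: "T_circ B \<subseteq> T_plus B"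
proof
  fix x assume "x \<in> T_circ B"
  then obtain n :: nat where n: "n > 0" "x [^] n = \<zero>" and x: "x \<in> carrier B"
    by (auto simp: T_circ_def torsion_def one_eq_zero)
  obtain t where t: "t \<in> T_plus B" "\<zero> = t \<oplus> x \<cdot> n"
    using circ_pow_congruent_multiple[OF x, of n] n by auto
  have c: "t \<in> carrier B" "x \<cdot> n \<in> carrier B"
    using t T_plus_subset add.nat_pow_closed[of x n] x by auto
  have "x \<cdot> n = \<ominus> t \<oplus> (t \<oplus> x \<cdot> n)" using c by simp
  also have "\<dots> = \<ominus> t" using c unfolding t(2)[symmetric] by simp
  finally have "x \<cdot> n \<in> T_plus B" using T_plus_closed(2)[OF t(1)] by simp
  then show "x \<in> T_plus B"
    using add.torsion_of_power[of x n] x n by (simp add: T_plus_def)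
qed

lemma T_plus_sub_skew_brace: "sub_skew_brace (T_plus B) B"
  by (rule left_ideal_imp_sub_skew_brace[OF normal_imp_subgroup[OF T_plus_normal]])
    (rule lam_T_plus)

text \<open>
  Some power \<open>y\<close> of \<open>x\<close> in \<open>(B, \<circ>)\<close> satisfies \<open>\<lambda>\<^sub>y(x) = x\<close>.  Then \<open>\<lambda>\<^sub>y\<close> fixes all powers of
  \<open>x\<close>, in particular \<open>y\<close>, so the powers of \<open>y\<close> in \<open>(B, \<circ>)\<close> are its multiples in \<open>(B, +)\<close>.  Since
  \<open>y\<close> lies in the sub-skew brace \<open>T\<^sub>+\<close>, one of them is \<open>0\<close>.
\<close>

lemma T_plus_subset_T_circ: "T_plus B \<subseteq> T_circ B"
proof
  fix x assume xT: "x \<in> T_plus B"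
  then have x: "x \<in> carrier B" using T_plus_subset by blast
  obtain m :: nat where m: "m > 0" "x [^] m \<in> Fix_l B x \<inter> centraliser B x"
    using power_mem_finite_index[OF fix_l_index[OF x] _ _ x] zero_mem_fixed[OF x]
    by (auto simp: centraliser_def)
  define y where "y = x [^] m"
  have y: "y \<in> carrier B" using x by (simp add: y_def)
  have fix_x: "lam B y x = x" using m x by (simp add: y_def Fix_l_iff)
  have "lam B y (x [^] i) = x [^] i" for i :: nat
  proof (induction i)
    case 0
    show ?case using y by (simp add: one_eq_zero lam_zero)
  next
    case (Suc i)
    define p where "p = x [^] i"
    have p: "p \<in> carrier B" using x by (simp add: p_def)
    \<comment> \<open>Both \<open>p\<close> and \<open>y\<close> are powers of \<open>x\<close>, so they commute and so do \<open>\<lambda>\<^sub>p\<close> and \<open>\<lambda>\<^sub>y\<close>.\<close>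
    have "lam B y (lam B p x) = lam B p (lam B y x)"
      using x y p by (simp add: lam_times[symmetric]) (simp add: y_def p_def nat_pow_mult add.commute)
    then show ?case
      using Suc fix_x x y p by (simp add: p_def[symmetric] times_eq_plus_lam lam_plus)
  qed
  then have fix_y: "lam B y y = y" by (simp add: y_def)
  have pow: "y [^] k = y \<cdot> k" for k :: nat
  proof (induction k)
    case (Suc k)
    have yk: "y \<cdot> k \<in> carrier B" using add.nat_pow_closed[of y k] y by simp
    have "lam B y (y \<cdot> k) = y \<cdot> k"
      using group_hom.hom_nat_pow[OF lam_group_hom[OF y], of y k] y fix_y by simp
    then have "y \<otimes> y \<cdot> k = y \<oplus> y \<cdot> k" using y yk by (simp add: times_eq_plus_lam)
    moreover have "y [^] Suc k = y \<otimes> y \<cdot> k" using y by (simp only: Suc[symmetric] nat_pow_Suc2)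
    moreover have "y \<cdot> Suc k = y \<oplus> y \<cdot> k" using add.nat_pow_Suc2[of y k] y by simp
    ultimately show ?case by simp
  qed (simp add: one_eq_zero)
  have "subgroup (T_plus B) B" using T_plus_sub_skew_brace by (simp add: sub_skew_brace_def)
  then have "y \<in> T_plus B"
    unfolding y_def using xT
    by (induction m) (auto simp: subgroup.one_closed subgroup.m_closed)
  then obtain k :: nat where k: "k > 0" "y \<cdot> k = \<zero>" by (auto simp: T_plus_def torsion_def)
  then have "x [^] (m * k) = \<one>"
    using x pow[of k] by (simp add: y_def nat_pow_pow one_eq_zero)
  then show "x \<in> T_circ B"
    using x m k by (auto simp: T_circ_def torsion_def intro!: exI[of _ "m * k"])
qed

lemma T_plus_eq_T_circ: "T_plus B = T_circ B"
  using T_plus_subset_T_circ T_circ_subset_T_plus by blast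

lemma T_plus_brace_ideal: "brace_ideal (T_plus B) B"
proof -
  have "T_plus B \<lhd> B" using torsion_normal by (simp add: T_plus_eq_T_circ T_circ_def)
  then show ?thesis using T_plus_normal lam_T_plus by (auto simp: brace_ideal_def)
qed

lemma T_plus_quotient_trivial:
  "T_plus (B Quot (T_plus B)) = {\<zero>\<^bsub>B Quot (T_plus B)\<^esub>}"
proof -
  let ?T = "T_plus B" and ?Q = "B Quot (T_plus B)"
  note q = brace_quot_simps[OF T_plus_brace_ideal]
  have T: "subgroup ?T (add_monoid B)" using T_plus_normal normal_imp_subgroup by blast
  have T0: "?T +> \<zero> = ?T"
    using add.coset_mult_one[of ?T] T_plus_subset by (simp add: a_r_coset_def)
  have pow: "(?T +> a) [^]\<^bsub>add_monoid ?Q\<^esub> n = ?T +> (a \<cdot> n)" if a: "a \<in> carrier B" for a and n :: nat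
  proof (induction n)
    case 0
    show ?case by (simp add: q T0)
  next
    case (Suc n)
    have "a \<cdot> n \<in> carrier B" using add.nat_pow_closed[of a n] a by simp
    then show ?case using Suc a by (simp add: q(4))
  qed
  have mem: "?T +> a = ?T" if x: "?T +> a \<in> torsion (add_monoid ?Q)" and a: "a \<in> carrier B" for a
  proof -
    obtain n :: nat where n: "n > 0" "?T +> (a \<cdot> n) = ?T"
      using x pow[OF a] by (auto simp: torsion_def q)
    have "a \<cdot> n \<in> carrier B" using add.nat_pow_closed[of a n] a by simp
    then have "a \<cdot> n \<in> ?T"
      using add.coset_join1[of ?T "a \<cdot> n"] n(2) T T_plus_subset by (simp add: a_r_coset_def)
    then have "a \<in> ?T" using add.torsion_of_power[of a n] a n(1) by (simp add: T_plus_def)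
    then show ?thesis using add.coset_join2[of a ?T] T a by (simp add: a_r_coset_def)
  qed
  have "torsion (add_monoid ?Q) \<subseteq> {?T}"
  proof
    fix X assume X: "X \<in> torsion (add_monoid ?Q)"
    then obtain a where "a \<in> carrier B" "X = ?T +> a" by (auto simp: torsion_def q)
    then show "X \<in> {?T}" using mem X by auto
  qed
  moreover have "?T \<in> torsion (add_monoid ?Q)"
  proof -
    have "?T \<in> carrier ?Q" using T0 by (force simp: q)
    moreover have "?T [^]\<^bsub>add_monoid ?Q\<^esub> Suc 0 = ?T" using pow[of \<zero> 1] T0 by simp
    ultimately show ?thesis unfolding torsion_def by (auto simp: q intro!: exI[of _ "Suc 0"])
  qed
  ultimately show ?thesis by (auto simp: T_plus_def[of ?Q] q)
qed

lemma finite_lam_orbit: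
  assumes x: "x \<in> carrier B"
  shows "finite ((\<lambda>a. lam B a x) ` carrier B)"
proof -
  \<comment> \<open>The inverse turns the right cosets of the stabiliser into fibres of the orbit map.\<close>
  have "finite ((\<lambda>a. lam B (inv a) x) ` carrier B)"
  proof (rule finite_image_if_left_invariant[OF fix_l_index[OF x]])
    fix h g assume h: "h \<in> Fix_l B x \<inter> centraliser B x" and g: "g \<in> carrier B"
    then have hc: "h \<in> carrier B" and hx: "lam B h x = x" using x by (auto simp: Fix_l_iff)
    have "lam B (inv h) x = lam B (inv h) (lam B h x)" by (simp add: hx)
    also have "\<dots> = x" using hc x by (simp add: lam_times[symmetric] lam_one)
    finally show "lam B (inv (h \<otimes> g)) x = lam B (inv g) x"
      using hc g x by (simp add: inv_mult_group lam_times)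
  qed (use zero_mem_fixed[OF x] in \<open>auto simp: centraliser_def\<close>)
  moreover have "(\<lambda>a. lam B a x) ` carrier B \<subseteq> (\<lambda>a. lam B (inv a) x) ` carrier B"
    by (intro image_subsetI image_eqI[of _ _ "inv _"]) auto
  ultimately show ?thesis by (rule rev_finite_subset)
qed

text \<open>
  The union \<open>F\<close> of the \<open>\<lambda>\<close>-orbits of the finitely many generators is finite.  The additive
  subgroup generated by \<open>F\<close> is \<open>\<lambda>\<close>-invariant, hence a sub-skew brace, and it contains the
  generators of \<open>B\<close>.
\<close>

lemma finitely_generated_additive_group:
  assumes "finitely_generated_brace B"
  obtains F where "finite F" "F \<subseteq> carrier B" "generate (add_monoid B) F = carrier B"
proof -
  obtain E where E: "finite E" "E \<subseteq> carrier B"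
    "\<Inter>{H. sub_skew_brace H B \<and> E \<subseteq> H} = carrier B"
    using assms by (auto simp: finitely_generated_brace_def)
  define F where "F = (\<Union>x\<in>E. (\<lambda>a. lam B a x) ` carrier B)"
  have F: "finite F" "F \<subseteq> carrier B"
    using E finite_lam_orbit by (auto simp: F_def subset_iff)
  define M where "M = generate (add_monoid B) F"
  have M: "subgroup M (add_monoid B)"
    unfolding M_def by (rule add.generate_is_subgroup) (use F in simp)
  have M_sub: "M \<subseteq> carrier B" using subgroup.subset[OF M] by simp
  have F_lam: "lam B a b \<in> F" if a: "a \<in> carrier B" and b: "b \<in> F" for a b
  proof -
    obtain x c where xc: "x \<in> E" "c \<in> carrier B" "b = lam B c x" using b by (auto simp: F_def)
    then have "lam B a b = lam B (a \<otimes> c) x" using a E(2) by (auto simp: lam_times)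
    then show ?thesis using xc a unfolding F_def by blast
  qed
  have "lam B a b \<in> M" if a: "a \<in> carrier B" and b: "b \<in> M" for a b
    using b unfolding M_def
  proof induction
    case one
    show ?case using a generate.one[of "add_monoid B" F] by (simp add: lam_zero)
  next
    case (incl h)
    then show ?case using F_lam[OF a] by (intro generate.incl)
  next
    case (inv h)
    then have "lam B a (inv\<^bsub>add_monoid B\<^esub> h) = inv\<^bsub>add_monoid B\<^esub> lam B a h"
      using lam_neg[OF a] F(2) by (auto simp: a_inv_def)
    then show ?case using generate.inv[OF F_lam[OF a inv]] by metis
  next
    case (eng g h)
    then have "lam B a (g \<oplus> h) = lam B a g \<oplus> lam B a h"
      using lam_plus[OF a] M_sub by (auto simp: M_def)
    then show ?case using generate.eng[OF eng.IH] by simp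
  qed
  then have "sub_skew_brace M B" by (rule left_ideal_imp_sub_skew_brace[OF M])
  moreover have "E \<subseteq> M"
  proof
    fix x assume x: "x \<in> E"
    then have "x = lam B \<one> x" using E(2) lam_one by (metis subsetD)
    then have "x \<in> F" using x unfolding F_def by blast
    then show "x \<in> M" unfolding M_def by (rule generate.incl)
  qed
  ultimately have "carrier B \<subseteq> M" using E(3) by blast
  then show thesis using that F M_sub by (auto simp: M_def)
qed

lemma finite_T_plus:
  assumes "finitely_generated_brace B"
  shows "finite (T_plus B)"
proof -
  obtain F where "finite F" "F \<subseteq> carrier B" "generate (add_monoid B) F = carrier B"
    using finitely_generated_additive_group[OF assms] .
  then show ?thesis
    using add.finite_torsion_if_finitely_generated[of F] by (simp add: T_plus_def)
qed

end

theorem theorem3p18: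
  fixes B :: "('a, 'm) ring_scheme"
  assumes "skew_brace B" and "property_S B"
  shows "T_plus B = T_circ B \<and>
    brace_ideal (T_plus B) B \<and>
    T_plus (B Quot (T_plus B)) = {\<zero>\<^bsub>B Quot (T_plus B)\<^esub>} \<and>
    (finitely_generated_brace B \<longrightarrow> finite (T_plus B))"
proof -
  interpret skew_brace_S B
    using assms by (intro skew_brace_S.intro skew_brace_S_axioms.intro)
  show ?thesis
    using T_plus_eq_T_circ T_plus_brace_ideal T_plus_quotient_trivial finite_T_plus by blast
qed

end
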